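(* For any positive integer $n$, $$\chi_{2scf}(H_n)=\left\lfloor\log_{\frac{1+\sqrt{5}}{2}}\left(\sqrt{5}\left(n+\frac{1}{2}\right)\right)\right\rfloor-1.$$
   Context: For a positive integer $n$, let $H_n=(V_n,\mathcal{E}_n)$ be the hypergraph with vertex set $V_n=\{1,2,\dots,n\}$ and hyperedge set $\mathcal{E}_n$ consisting of all non-empty subsets of $V_n$ made of consecutive integers, i.e. all sets $\{i,i+1,\dots,j\}$ with $1\le i\le j\le n$. For a positive integer $k$, a coloring $\phi:V\to\{1,\ldots,m\}$ of a hypergraph $H=(V,\mathcal{E})$ is called a $k$-SCF-coloring ($k$-strong-conflict-free coloring) if for every $e\in\mathcal{E}$ with $|e|\geq k$ there are at least $k$ colors which appear exactly once in $e$ (i.e. are the color of exactly one vertex of $e$), and for every $e\in\mathcal{E}$ with $|e|<k$ all vertices of $e$ have different colors. The chromatic number $\chi_{kscf}(H)$ is the smallest number of colors in any $k$-SCF-coloring of $H$; $\chi_{2scf}$ is the case $k=2$. $\lfloor x\rfloor$ denotes the largest integer that is less than or equal to $x$. *)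

theory Defs
  imports Complex_Main
begin

type_synonym 'a hypergraph = "'a set \<times> 'a set set"

abbreviation verts :: "'a hypergraph \<Rightarrow> 'a set" where
  "verts H \<equiv> fst H"

abbreviation hyperedges :: "'a hypergraph \<Rightarrow> 'a set set" where
  "hyperedges H \<equiv> snd H"

definition interval_hypergraph :: "nat \<Rightarrow> nat hypergraph" where
  "interval_hypergraph n = ({1..n}, {{i..j} | i j. 1 \<le> i \<and> i \<le> j \<and> j \<le> n})"

(* The notions below are meant for k \<ge> 1 and finite hypergraphs whose hyperedges are subsets
   of the vertex set: card is 0 on infinite sets. A coloring is a total function of which only
   the values on the vertices matter; it need not use all of the colors 1, ..., m. *)

definition unique_colors :: "('a \<Rightarrow> nat) \<Rightarrow> 'a set \<Rightarrow> nat set" where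
  "unique_colors \<phi> e = {c. \<exists>!v. v \<in> e \<and> \<phi> v = c}"

definition is_kscf_coloring :: "nat \<Rightarrow> 'a hypergraph \<Rightarrow> nat \<Rightarrow> ('a \<Rightarrow> nat) \<Rightarrow> bool" where
  "is_kscf_coloring k H m \<phi> \<longleftrightarrow>
     (\<forall>v\<in>verts H. \<phi> v \<in> {1..m}) \<and>
     (\<forall>e\<in>hyperedges H. card e \<ge> k \<longrightarrow> card (unique_colors \<phi> e) \<ge> k) \<and>
     (\<forall>e\<in>hyperedges H. card e < k \<longrightarrow> inj_on \<phi> e)"

(* For a finite hypergraph such an m exists, since an injective coloring of the vertices
   satisfies the conditions. *)
definition chi_kscf :: "nat \<Rightarrow> 'a hypergraph \<Rightarrow> nat" where
  "chi_kscf k H = (LEAST m. \<exists>\<phi>. is_kscf_coloring k H m \<phi>)"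

end

theory Submission
  imports Defs "HOL-Number_Theory.Fib" "HOL-Library.Sublist" "HOL-Combinatorics.Transposition"
begin

text \<open>
  A coloring of \<open>1, ..., n\<close> is a word of length \<open>n\<close>, and the condition says that every factor of
  length at least 2 has two letters occurring exactly once in it. The theorem amounts to the fact
  that the longest such word over \<open>m\<close> letters has length \<open>fib (m + 2) - 1\<close>; write \<open>L m\<close> for this
  number, so that \<open>L (m + 2) = L (m + 1) + 1 + L m\<close>.

  Upper bound (\<open>scf_word_length\<close>): let \<open>p\<close> and \<open>q\<close>, in this order, be two letters that occur
  once in the whole word, so that it reads \<open>A p B q C\<close>. The factor \<open>A p B\<close> avoids \<open>q\<close>, and \<open>C\<close>
  avoids both letters; induction bounds their lengths by \<open>L (m + 1)\<close> and \<open>L m\<close>.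

  Lower bound (\<open>fib_word_exists\<close>): equality forces \<open>A p B\<close> and \<open>B q C\<close> to be extremal words with
  one letter fewer, overlapping in \<open>B\<close>. Conversely, any two admissible words \<open>A p B\<close> and \<open>B q C\<close> can
  be glued along \<open>B\<close> if \<open>p\<close> and \<open>q\<close> are distinct letters that do not occur in \<open>A\<close>, \<open>B\<close>, \<open>C\<close>:
  a factor that misses \<open>p\<close> or \<open>q\<close> lies in one of the two words, and one that contains both
  has \<open>p\<close> and \<open>q\<close> themselves as unique letters (\<open>scf_word_glue\<close>). Given \<open>A p B\<close>, a suitable
  \<open>B q C\<close> is obtained by reversing it and renaming its letters, provided the renaming turns \<open>B\<close>
  into its reversal. This is arranged by keeping all words involved \<^emph>\<open>palindromic up to an
  involution of the letters\<close>, a property which the gluing step reproduces (\<open>fib_word_step\<close>).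

  Hence the chromatic number is the least \<open>m\<close> with \<open>n < fib (m + 2)\<close>. Binet's formula turns
  \<open>fib j \<le> n < fib (j + 1)\<close> into the value \<open>j\<close> of the floor of the logarithm: the error term in
  the formula has absolute value at most 1, which is less than \<open>sqrt 5 / 2\<close>, so that the summand
  \<open>1 / 2\<close> absorbs it on both sides (\<open>floor_log_fib\<close>).
\<close>

section \<open>Words whose long factors have two unique letters\<close>

definition two_unique :: "'a list \<Rightarrow> bool" where
  "two_unique w \<longleftrightarrow> (\<exists>a b. a \<noteq> b \<and> count_list w a = 1 \<and> count_list w b = 1)"

definition scf_word :: "'a list \<Rightarrow> bool" where
  "scf_word w \<longleftrightarrow> (\<forall>v. sublist v w \<and> 2 \<le> length v \<longrightarrow> two_unique v)"

lemma scf_word_sublist: "scf_word w \<Longrightarrow> sublist v w \<Longrightarrow> scf_word v"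
  unfolding scf_word_def by (meson sublist_order.order_trans)

lemma two_unique_rev: "two_unique (rev w) = two_unique w"
  by (simp add: two_unique_def)

lemma scf_word_rev: "scf_word w \<Longrightarrow> scf_word (rev w)"
  unfolding scf_word_def by (metis length_rev rev_rev_ident sublist_rev two_unique_rev)

lemma scf_word_map:
  assumes "inj_on f (set w)" "scf_word w"
  shows "scf_word (map f w)"
  unfolding scf_word_def
proof (intro allI impI)
  fix v assume v: "sublist v (map f w) \<and> 2 \<le> length v"
  then obtain u where u: "sublist u w" "v = map f u"
    by (blast dest: sublist_map_rightE)
  with v assms(2) obtain a b where ab: "a \<noteq> b" "count_list u a = 1" "count_list u b = 1"
    unfolding scf_word_def two_unique_def by auto
  then have in_u: "a \<in> set u" "b \<in> set u" by (metis count_notin zero_neq_one)+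
  have inj: "inj_on f (set u)" using assms(1) set_mono_sublist[OF u(1)] by (rule inj_on_subset)
  then have "f a \<noteq> f b" using in_u ab(1) by (metis inj_onD)
  then show "two_unique v"
    using ab in_u inj u(2) unfolding two_unique_def by (metis count_list_inj_map)
qed

lemma count_list_1_split:
  assumes "count_list w a = 1"
  obtains u v where "w = u @ a # v" "a \<notin> set u" "a \<notin> set v"
proof -
  have "a \<in> set w" using assms by (metis count_notin zero_neq_one)
  then obtain u v where "w = u @ a # v" "a \<notin> set u" by (meson split_list_first)
  with assms that show thesis by (auto simp: count_list_0_iff)
qed

lemma two_unique_split:
  assumes "two_unique w"
  obtains A p B q C where "w = A @ p # B @ q # C" "p \<noteq> q"
    "p \<notin> set A \<union> set B \<union> set C" "q \<notin> set A \<union> set B \<union> set C"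
proof -
  from assms obtain a b where ab: "a \<noteq> b" "count_list w a = 1" "count_list w b = 1"
    unfolding two_unique_def by blast
  from count_list_1_split[OF ab(2)] obtain u v
    where w: "w = u @ a # v" and a: "a \<notin> set u" "a \<notin> set v" by blast
  have "count_list u b + count_list v b = 1" using ab w by auto
  then consider "count_list u b = 1" "count_list v b = 0" | "count_list u b = 0" "count_list v b = 1"
    by linarith
  then show thesis
  proof cases
    case 1
    from count_list_1_split[OF 1(1)] obtain x y where "u = x @ b # y" "b \<notin> set x" "b \<notin> set y" by blast
    with that[of x b y a v] 1(2) ab a w show thesis by (auto simp: count_list_0_iff)
  next
    case 2
    from count_list_1_split[OF 2(2)] obtain x y where "v = x @ b # y" "b \<notin> set x" "b \<notin> set y" by blast
    with that[of u a x b y] 2(1) ab a w show thesis by (auto simp: count_list_0_iff)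
  qed
qed

section \<open>Upper bound on the length\<close>

text \<open>
  The bound comes from cutting the word just before the second of its two unique letters: the part to
  the left has lost one letter, the part to the right both.\<close>

lemma scf_word_length:
  assumes "scf_word w" "set w \<subseteq> K" "finite K" "card K \<le> m"
  shows "length w < fib (m + 2)"
  using assms
proof (induction m arbitrary: w K rule: fib.induct)
  case 1
  then show ?case by auto
next
  case 2
  have "length w < 2"
  proof (rule ccontr)
    assume "\<not> length w < 2"
    then have "two_unique w" using 2 by (auto simp: scf_word_def)
    then obtain A p B q C where "w = A @ p # B @ q # C" "p \<noteq> q" by (rule two_unique_split)
    then have "card {p, q} \<le> card K" using 2 by (intro card_mono) auto
    then show False using 2 \<open>p \<noteq> q\<close> by simp
  qed
  then show ?case by (simp add: numeral_3_eq_3)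
next
  case (3 m)
  have fib: "fib (Suc (Suc m) + 2) = fib (Suc m + 2) + fib (m + 2)" by simp
  show ?case
  proof (cases "length w < 2")
    case True
    then show ?thesis unfolding fib using fib_neq_0_nat[of "Suc m + 2"] fib_neq_0_nat[of "m + 2"] by linarith
  next
    case False
    then have "two_unique w" using 3(3) by (auto simp: scf_word_def)
    then obtain A p B q C where w: "w = A @ p # B @ q # C" and pq: "p \<noteq> q"
      "p \<notin> set A \<union> set B \<union> set C" "q \<notin> set A \<union> set B \<union> set C" by (rule two_unique_split)
    have K: "p \<in> K" "q \<in> K" using 3(4) w by auto
    have "sublist (A @ p # B) w"
      using sublist_append_rightI[of "A @ p # B" "q # C"] by (simp add: w)
    moreover have "sublist C w"
      using sublist_append_leftI[of C "A @ p # B @ [q]"] by (simp add: w)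
    ultimately have good: "scf_word (A @ p # B)" "scf_word C" using scf_word_sublist[OF 3(3)] by blast+
    have "length (A @ p # B) < fib (Suc m + 2)"
      using 3(4-6) K pq w by (intro 3(1)[OF good(1), of "K - {q}"]) auto
    moreover have "length C < fib (m + 2)"
      using 3(4-6) K pq w by (intro 3(2)[OF good(2), of "K - {p, q}"]) (auto simp: card_Diff_subset)
    ultimately show ?thesis unfolding fib w by simp
  qed
qed

section \<open>Gluing words along a common factor\<close>

lemma sublist_avoiding:
  assumes "sublist v (X @ q # Y)" "q \<notin> set v"
  shows "sublist v X \<or> sublist v Y"
  using assms by (auto simp: sublist_append sublist_Cons_right prefix_Cons)

lemma count_list_sublist_le: "sublist v w \<Longrightarrow> count_list v a \<le> count_list w a"
  by (auto simp: sublist_def)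

text \<open>
  A factor that misses \<open>q\<close> lies in \<open>A p B\<close> or in \<open>C\<close>, one that misses \<open>p\<close> lies in \<open>A\<close> or in
  \<open>B q C\<close>. A factor containing both has \<open>p\<close> and \<open>q\<close> as its two unique letters.\<close>

lemma scf_word_glue:
  assumes "scf_word (A @ p # B)" "scf_word (B @ q # C)" "p \<noteq> q"
    "p \<notin> set A \<union> set B \<union> set C" "q \<notin> set A \<union> set B \<union> set C"
  shows "scf_word (A @ p # B @ q # C)" (is "scf_word ?w")
  unfolding scf_word_def
proof (intro allI impI)
  fix v assume v: "sublist v ?w \<and> 2 \<le> length v"
  have le: "count_list v p \<le> 1" "count_list v q \<le> 1"
    using v count_list_sublist_le[of v ?w p] count_list_sublist_le[of v ?w q] assms by auto
  consider "q \<notin> set v" | "p \<notin> set v" | "p \<in> set v" "q \<in> set v" by blast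
  then show "two_unique v"
  proof cases
    case 1
    then have "sublist v (A @ p # B) \<or> sublist v C"
      using v sublist_avoiding[of v "A @ p # B" q C] by auto
    moreover have "sublist C (B @ q # C)" by (simp add: sublist_append sublist_Cons_right)
    ultimately show ?thesis using assms v unfolding scf_word_def by (meson sublist_order.order_trans)
  next
    case 2
    then have "sublist v A \<or> sublist v (B @ q # C)"
      using v sublist_avoiding[of v A p "B @ q # C"] by auto
    moreover have "sublist A (A @ p # B)" by (simp add: sublist_append)
    ultimately show ?thesis using assms v unfolding scf_word_def by (meson sublist_order.order_trans)
  next
    case 3
    then have "count_list v p \<noteq> 0" "count_list v q \<noteq> 0" by (auto simp: count_list_0_iff)
    with le have "count_list v p = 1" "count_list v q = 1" by auto
    then show ?thesis using assms(3) unfolding two_unique_def by blast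
  qed
qed

section \<open>Words of extremal length\<close>

text \<open>
  The word is a palindrome up to the involution \<open>f\<close> of its letters. Fixing the numbers from \<open>m\<close> on
  makes \<open>f\<close> a permutation of the letters \<open>0, ..., m - 1\<close> and keeps it usable when the alphabet grows.\<close>

definition reversing :: "nat \<Rightarrow> (nat \<Rightarrow> nat) \<Rightarrow> nat list \<Rightarrow> bool" where
  "reversing m f w \<longleftrightarrow> (\<forall>x. f (f x) = x) \<and> (\<forall>x\<ge>m. f x = x) \<and> map f w = rev w"

text \<open>
  The induction invariant for the construction. For \<open>m \<ge> 2\<close> the lengths say that \<open>A\<close>, \<open>B\<close> and
  the whole word are as long as is possible with \<open>m - 1\<close>, \<open>m - 2\<close> and \<open>m\<close> letters. The
  involution for \<open>B\<close> is what the next step needs; those for the whole word and for \<open>A\<close> are there to supply the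
  involutions of the later words. That \<open>p\<close> is fixed makes the involutions for \<open>A\<close> and \<open>B\<close>
  compatible with exchanging \<open>p\<close> and a new letter.\<close>

definition fib_word :: "nat \<Rightarrow> nat list \<Rightarrow> nat \<Rightarrow> nat list \<Rightarrow> bool" where
  "fib_word m A p B \<longleftrightarrow> scf_word (A @ p # B) \<and> set (A @ p # B) \<subseteq> {..<m} \<and>
     p \<notin> set A \<union> set B \<and> length A + 1 = fib (m + 1) \<and> length B + 1 = fib m \<and>
     (\<exists>f. reversing m f (A @ p # B)) \<and>
     (\<exists>f. reversing m f A \<and> f p = p) \<and> (\<exists>f. reversing m f B \<and> f p = p)"

text \<open>
  Let \<open>s\<close> reverse \<open>B\<close> and let \<open>f\<close> be \<open>s\<close> followed by the exchange of \<open>p\<close> with the new letter \<open>m\<close>.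
  Renaming \<open>A p B\<close> by \<open>f\<close> and reversing gives \<open>B m C\<close> with \<open>C = rev (map s A)\<close>, which is glued
  to \<open>A p B\<close>. The result is reversed by \<open>f\<close>, which takes \<open>A\<close> to \<open>rev C\<close>, hence, being an
  involution, also \<open>C\<close> to \<open>rev A\<close>. In the new decomposition the left
  part is the old word, which is reversed by the old involution \<open>r\<close>, and the right part \<open>C\<close> is reversed by the conjugate of \<open>t\<close> by \<open>s\<close>, where
  \<open>t\<close> reverses \<open>A\<close>.\<close>

lemma fib_word_step:
  assumes "fib_word m A p B"
  shows "\<exists>C. fib_word (Suc m) (A @ p # B) m C"
proof -
  from assms obtain r s t where
    good: "scf_word (A @ p # B)" and sub: "set (A @ p # B) \<subseteq> {..<m}" and p: "p \<notin> set A \<union> set B"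
    and len: "length A + 1 = fib (m + 1)" "length B + 1 = fib m"
    and r: "reversing m r (A @ p # B)" and t: "reversing m t A" "t p = p"
    and s: "reversing m s B" "s p = p"
    unfolding fib_word_def by blast
  define C where "C = rev (map s A)"
  define f where "f = transpose p m \<circ> s"
  have ss: "s (s x) = x" and sm: "x \<ge> m \<Longrightarrow> s x = x" and sB: "map s B = rev B" for x
    using s unfolding reversing_def by auto
  have tt: "t (t x) = x" and tm: "x \<ge> m \<Longrightarrow> t x = x" and tA: "map t A = rev A" for x
    using t unfolding reversing_def by auto
  have pm: "p < m" using sub by auto
  have s_lt: "s x < m" if "x < m" for x by (metis that ss sm not_le)
  have s_p: "s x = p \<longleftrightarrow> x = p" for x by (metis ss s(2))
  have f_p: "f p = m" "f m = p" using sm[of m] s(2) by (auto simp: f_def)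
  have f_s: "f x = s x" if "x \<noteq> p" "x < m" for x
    using that s_lt[of x] s_p[of x] by (auto simp: f_def transpose_def)
  have ff: "f (f x) = x" for x
  proof (cases "x = p \<or> x = m")
    case False
    then have "s x \<noteq> p" "s x \<noteq> m" using s_p[of x] ss[of x] sm[of m] by auto
    then show ?thesis using False by (simp add: f_def transpose_def ss)
  qed (auto simp: f_p)
  have fm: "f x = x" if "x > m" for x using that pm sm[of x] by (simp add: f_def transpose_def)
  have inj: "inj_on f (set (A @ p # B))" by (metis ff inj_onI)
  have fA: "map f A = rev C" using sub p by (auto simp: C_def intro!: f_s)
  have fB: "map f B = rev B" unfolding sB[symmetric] using sub p by (auto intro!: f_s)
  have fC: "map f C = rev A"
  proof -
    have "map f (map f A) = A" by (simp add: ff map_idI)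
    then show ?thesis by (simp add: fA rev_map flip: rev_swap)
  qed
  have "set C = s ` set A" by (simp add: C_def)
  moreover have "s x < m \<and> s x \<noteq> p" if "x \<in> set A" for x
    using that sub p s_lt s_p by (metis Un_iff append_Cons lessThan_iff set_append subsetD)
  ultimately have subC: "set C \<subseteq> {..<m}" "p \<notin> set C" by auto
  have "scf_word (rev (map f (A @ p # B)))" by (rule scf_word_rev[OF scf_word_map[OF inj good]])
  then have "scf_word (B @ m # C)" by (simp add: fA fB f_p)
  then have g: "scf_word (A @ p # B @ m # C)"
    using good pm sub p subC by (intro scf_word_glue) auto
  have "reversing (Suc m) f (A @ p # B @ m # C)"
    unfolding reversing_def using ff fm fA fB fC f_p by auto
  moreover have "reversing (Suc m) r (A @ p # B)" "r m = m"
    using r unfolding reversing_def by auto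
  moreover have "reversing (Suc m) (s \<circ> t \<circ> s) C" "(s \<circ> t \<circ> s) m = m"
  proof -
    have "map (s \<circ> t \<circ> s) C = rev (map s (map t (map s (map s A))))"
      by (simp add: C_def rev_map o_assoc)
    also have "map s (map s A) = A" by (simp add: ss map_idI)
    also have "rev (map s (map t A)) = rev C" by (simp add: tA C_def rev_map)
    finally have "map (s \<circ> t \<circ> s) C = rev C" .
    then show "reversing (Suc m) (s \<circ> t \<circ> s) C"
      unfolding reversing_def using ss tt sm tm by simp
    show "(s \<circ> t \<circ> s) m = m" by (simp add: sm tm)
  qed
  ultimately have "fib_word (Suc m) (A @ p # B) m C"
    unfolding fib_word_def using g sub subC len p pm by (auto simp: C_def)
  then show ?thesis ..
qed

lemma fib_word_exists:
  assumes "m \<ge> 1"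
  shows "\<exists>A p B. fib_word m A p B"
  using assms
proof (induction m rule: nat_induct_at_least)
  case base
  have "scf_word [0::nat]"
    unfolding scf_word_def by (auto dest: sublist_length_le)
  then have "fib_word 1 [] 0 []" unfolding fib_word_def reversing_def by auto
  then show ?case by blast
next
  case (Suc m)
  then show ?case using fib_word_step by blast
qed

lemma scf_word_exists_iff:
  assumes "n \<ge> 1"
  shows "(\<exists>w. scf_word w \<and> set w \<subseteq> {..<m} \<and> length w = n) \<longleftrightarrow> n < fib (m + 2)"
proof
  assume "\<exists>w. scf_word w \<and> set w \<subseteq> {..<m} \<and> length w = n"
  then show "n < fib (m + 2)" using scf_word_length[of _ "{..<m}" m] by auto
next
  assume n: "n < fib (m + 2)"
  then have "m \<ge> 1" using assms by (cases m) auto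
  then obtain A p B where "fib_word m A p B" using fib_word_exists by blast
  then have w: "scf_word (A @ p # B)" "set (A @ p # B) \<subseteq> {..<m}" "length (A @ p # B) + 1 = fib (m + 2)"
    unfolding fib_word_def by auto
  let ?v = "take n (A @ p # B)"
  have "scf_word ?v" using w(1) scf_word_sublist sublist_take by blast
  moreover have "set ?v \<subseteq> {..<m}" using w(2) set_take_subset by (rule order_trans[rotated])
  moreover have "length ?v = n" using n w(3) by simp
  ultimately show "\<exists>w. scf_word w \<and> set w \<subseteq> {..<m} \<and> length w = n" by blast
qed

section \<open>Colorings of intervals as words\<close>

lemma unique_colors_set:
  assumes "distinct xs"
  shows "unique_colors \<phi> (set xs) = {c. count_list (map \<phi> xs) c = 1}"
proof -
  have "count_list (map \<phi> xs) c = card {v \<in> set xs. \<phi> v = c}" for c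
    using assms distinct_length_filter[of xs "\<lambda>v. \<phi> v = c"]
    by (simp add: count_list_eq_length_filter filter_map o_def Int_def conj_commute eq_commute)
  then show ?thesis
    unfolding unique_colors_def by (auto simp: card_1_singleton_iff set_eq_iff; metis)
qed

lemma two_unique_iff_card:
  "two_unique w \<longleftrightarrow> 2 \<le> card {c. count_list w c = 1}"
proof -
  have "{c. count_list w c = 1} \<subseteq> set w" by (metis (mono_tags) count_notin mem_Collect_eq subsetI zero_neq_one)
  then have fin: "finite {c. count_list w c = 1}" by (rule finite_subset) simp
  show ?thesis
    unfolding two_unique_def using fin card_le_Suc0_iff_eq[OF fin] by (auto simp: not_less_eq_eq numeral_2_eq_2)
qed

lemma sublist_map_upt_iff:
  "sublist v (map \<phi> [1..<Suc n]) \<and> v \<noteq> [] \<longleftrightarrow>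
     (\<exists>i j. 1 \<le> i \<and> i \<le> j \<and> j \<le> n \<and> v = map \<phi> [i..<Suc j])"
proof (intro iffI; (elim conjE exE)?)
  assume "sublist v (map \<phi> [1..<Suc n])" and ne: "v \<noteq> []"
  then obtain x y where eq: "map \<phi> [1..<Suc n] = x @ v @ y" unfolding sublist_def by blast
  have "v = take (length v) (drop (length x) (map \<phi> [1..<Suc n]))" unfolding eq by simp
  moreover have len: "length x + length v \<le> n" using arg_cong[OF eq, of length] by (simp del: upt_Suc)
  ultimately have "v = map \<phi> [1 + length x..<Suc (length x + length v)]"
    by (simp add: drop_map take_map drop_upt take_upt del: upt_Suc)
  then show "\<exists>i j. 1 \<le> i \<and> i \<le> j \<and> j \<le> n \<and> v = map \<phi> [i..<Suc j]"
    using ne len by (intro exI[of _ "1 + length x"] exI[of _ "length x + length v"]) (cases v; simp del: upt_Suc)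
next
  fix i j assume ij: "1 \<le> i" "i \<le> j" "j \<le> n" "v = map \<phi> [i..<Suc j]"
  have "[1..<Suc n] = [1..<i] @ [i..<Suc j] @ [Suc j..<Suc n]"
    using ij upt_add_eq_append[of 1 i "Suc n - i"] upt_add_eq_append[of i "Suc j" "n - j"]
    by (simp del: upt_Suc)
  then show "sublist v (map \<phi> [1..<Suc n]) \<and> v \<noteq> []"
    using ij unfolding sublist_def by (auto simp del: upt_Suc)
qed

lemma is_2scf_coloring_iff:
  "is_kscf_coloring 2 (interval_hypergraph n) m \<phi> \<longleftrightarrow>
     (\<forall>v\<in>{1..n}. \<phi> v \<in> {1..m}) \<and> scf_word (map \<phi> [1..<Suc n])"
proof -
  have uc: "card (unique_colors \<phi> {i..j}) \<ge> 2 \<longleftrightarrow> two_unique (map \<phi> [i..<Suc j])" for i j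
    using unique_colors_set[of "[i..<Suc j]" \<phi>]
    by (simp add: two_unique_iff_card atLeastLessThanSuc_atLeastAtMost del: upt_Suc)
  have inj: "inj_on \<phi> {i..j}" if "card {i..j} < 2" for i j :: nat
  proof -
    have "x = y" if "x \<in> {i..j}" "y \<in> {i..j}" for x y using that \<open>card {i..j} < 2\<close> by auto
    then show ?thesis by (auto intro: inj_onI)
  qed
  have "scf_word (map \<phi> [1..<Suc n]) \<longleftrightarrow>
      (\<forall>v. sublist v (map \<phi> [1..<Suc n]) \<and> v \<noteq> [] \<longrightarrow> 2 \<le> length v \<longrightarrow> two_unique v)"
    unfolding scf_word_def by fastforce
  also have "\<dots> \<longleftrightarrow> (\<forall>i j. 1 \<le> i \<and> i \<le> j \<and> j \<le> n \<longrightarrow>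
      2 \<le> length (map \<phi> [i..<Suc j]) \<longrightarrow> two_unique (map \<phi> [i..<Suc j]))"
    unfolding sublist_map_upt_iff by blast
  finally have word: "scf_word (map \<phi> [1..<Suc n]) \<longleftrightarrow> (\<forall>i j. 1 \<le> i \<and> i \<le> j \<and> j \<le> n \<longrightarrow>
      2 \<le> card {i..j} \<longrightarrow> two_unique (map \<phi> [i..<Suc j]))" by (simp del: upt_Suc)
  show ?thesis
    unfolding word is_kscf_coloring_def interval_hypergraph_def uc[symmetric]
    using inj by fastforce
qed

lemma colorable_iff:
  assumes "n \<ge> 1"
  shows "(\<exists>\<phi>. is_kscf_coloring 2 (interval_hypergraph n) m \<phi>) \<longleftrightarrow> n < fib (m + 2)"
  unfolding scf_word_exists_iff[OF assms, symmetric]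
proof
  assume "\<exists>\<phi>. is_kscf_coloring 2 (interval_hypergraph n) m \<phi>"
  then obtain \<phi> where \<phi>: "\<forall>v\<in>{1..n}. \<phi> v \<in> {1..m}" "scf_word (map \<phi> [1..<Suc n])"
    unfolding is_2scf_coloring_iff by blast
  \<comment> \<open>Colors start at 1, letters at 0; the shift is injective because no vertex has color 0.\<close>
  let ?w = "map (\<lambda>c. c - 1) (map \<phi> [1..<Suc n])"
  have set: "set (map \<phi> [1..<Suc n]) \<subseteq> {1..m}" using \<phi>(1) by (auto simp del: upt_Suc)
  have "inj_on (\<lambda>c. c - 1) {1..m}" by (auto intro!: inj_onI)
  then have "scf_word ?w" using set \<phi>(2) by (meson scf_word_map inj_on_subset)
  moreover have "set ?w \<subseteq> {..<m}" using set by fastforce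
  moreover have "length ?w = n" by simp
  ultimately show "\<exists>w. scf_word w \<and> set w \<subseteq> {..<m} \<and> length w = n" by blast
next
  assume "\<exists>w. scf_word w \<and> set w \<subseteq> {..<m} \<and> length w = n"
  then obtain w where w: "scf_word w" "set w \<subseteq> {..<m}" "length w = n" by blast
  define \<phi> where "\<phi> i = Suc (w ! (i - 1))" for i
  have "map \<phi> [1..<Suc n] = map Suc w"
    using w(3) by (auto simp: \<phi>_def intro!: nth_equalityI simp del: upt_Suc)
  moreover have "\<phi> v \<in> {1..m}" if "v \<in> {1..n}" for v
  proof -
    have "w ! (v - 1) \<in> set w" using that w(3) by (intro nth_mem) auto
    then show ?thesis using w(2) by (auto simp: \<phi>_def)
  qed
  ultimately show "\<exists>\<phi>. is_kscf_coloring 2 (interval_hypergraph n) m \<phi>"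
    unfolding is_2scf_coloring_iff using w(1) scf_word_map[of Suc w]
    by (intro exI[of _ \<phi>]) (simp del: upt_Suc)
qed

section \<open>Fibonacci numbers and the logarithm\<close>

text \<open>
  In \<open>sqrt 5 * fib k = g ^ k - h ^ k\<close> the last term has absolute value at most 1, and
  \<open>1 < sqrt 5 / 2\<close>. So \<open>sqrt 5 * (n + 1 / 2)\<close>, which exceeds \<open>sqrt 5 * fib j\<close> by at least
  \<open>sqrt 5 / 2\<close> and stays below \<open>sqrt 5 * fib (j + 1)\<close> by at least \<open>sqrt 5 / 2\<close>, lies between
  \<open>g ^ j\<close> and \<open>g ^ (j + 1)\<close>.\<close>

lemma floor_log_fib:
  assumes "fib j \<le> n" "n < fib (Suc j)"
  shows "\<lfloor>log ((1 + sqrt 5) / 2) (sqrt 5 * (real n + 1 / 2))\<rfloor> = int j"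
proof -
  define g h :: real where "g = (1 + sqrt 5) / 2" and "h = (1 - sqrt 5) / 2"
  have s: "sqrt 5 > 2" "sqrt 5 < 3" by (auto simp: real_less_rsqrt real_less_lsqrt)
  have "\<bar>h\<bar> < 1" unfolding h_def using s by auto
  then have h: "\<bar>h ^ k\<bar> \<le> 1" for k by (simp add: power_abs power_le_one)
  have binet: "sqrt 5 * real (fib k) = g ^ k - h ^ k" for k
    using fib_closed_form[of k] unfolding g_def h_def by (simp add: field_simps)
  have "g ^ j \<le> sqrt 5 * real (fib j) + 1" using binet[of j] h[of j] by linarith
  also have "\<dots> \<le> sqrt 5 * real n + sqrt 5 / 2" using assms s by (intro add_mono mult_left_mono) auto
  finally have lo: "g ^ j \<le> sqrt 5 * (real n + 1 / 2)" by (simp add: algebra_simps)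
  have "sqrt 5 * (real n + 1) \<le> sqrt 5 * real (fib (Suc j))" using assms s by (intro mult_left_mono) auto
  also have "\<dots> \<le> g ^ Suc j + 1" using binet[of "Suc j"] h[of "Suc j"] by linarith
  finally have hi: "sqrt 5 * (real n + 1 / 2) < g ^ Suc j" using s by (simp add: algebra_simps)
  have g: "g > 1" unfolding g_def using s by simp
  have x: "sqrt 5 * (real n + 1 / 2) > 0" by (intro mult_pos_pos) auto
  show ?thesis unfolding g_def[symmetric]
  proof (rule floor_unique)
    show "real_of_int (int j) \<le> log g (sqrt 5 * (real n + 1 / 2))"
      using lo g x by (simp add: le_log_iff powr_realpow)
    have "g powr (real_of_int (int j) + 1) = g ^ Suc j"
      using g powr_realpow[of g "Suc j"] by (simp add: add.commute)
    then show "log g (sqrt 5 * (real n + 1 / 2)) < real_of_int (int j) + 1"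
      using hi g x by (simp add: log_less_iff)
  qed
qed

section \<open>The chromatic number\<close>

theorem corollary2p4:
  fixes n :: nat
  assumes "n \<ge> 1"
  shows "int (chi_kscf 2 (interval_hypergraph n)) =
    \<lfloor>log ((1 + sqrt 5) / 2) (sqrt 5 * (real n + 1 / 2))\<rfloor> - 1"
proof -
  define m where "m = (LEAST m. n < fib (m + 2))"
  have chi: "chi_kscf 2 (interval_hypergraph n) = m"
    unfolding chi_kscf_def m_def colorable_iff[OF assms] ..
  have "k < fib (k + 2)" for k
  proof (induction k)
    case (Suc k)
    then show ?case using fib_neq_0_nat[of "k + 1"] by simp
  qed simp
  then have hi: "n < fib (m + 2)" unfolding m_def by (rule LeastI)
  then have "m \<noteq> 0" using assms by (intro notI) simp
  then have lo: "fib (m + 1) \<le> n"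
    using not_less_Least[of "m - 1" "\<lambda>m. n < fib (m + 2)"] \<open>m \<noteq> 0\<close> by (fold m_def) simp
  have "\<lfloor>log ((1 + sqrt 5) / 2) (sqrt 5 * (real n + 1 / 2))\<rfloor> = int (m + 1)"
    using hi lo by (intro floor_log_fib) auto
  then show ?thesis using chi by simp
qed

end
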